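(* Let $r>0$ be given and let $x_0\in\mathcal{B}(r)$ be an initial condition. Let $\delta>0$ and $\alpha\in\mathcal{A}$ be given. Suppose that a structured strategy $F_{\mathrm s}\in\mathbb{R}^{m\times n}$ satisfying SC$_2$ is given. If there exists $P_\alpha\succ0$ such that $$A_{\mathrm{cl}}(F_{\mathrm s})'P_\alpha+P_\alpha A_{\mathrm{cl}}(F_{\mathrm s})+Q_\alpha+F_{\mathrm s}'R_\alpha F_{\mathrm s}\prec0,$$ $$x_0'P_\alpha x_0<\delta,$$ where $A_{\mathrm{cl}}(F_{\mathrm s}):=A+BF_{\mathrm s}$, then $F_{\mathrm s}$ is a stabilizing guaranteed cost structured control, i.e. $F_{\mathrm s}\in\hat{\mathfrak g}_\alpha(\delta)$ and $A+BF_{\mathrm s}$ is Hurwitz.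
   Context: Notation: $'$ denotes transpose; $M\succ0$ (resp. $M\succeq 0$, $M\prec0$) means positive definite (resp. positive semidefinite, negative definite); $\oplus$ is the direct sum of matrices; a square real matrix is Hurwitz if all its eigenvalues have negative real parts; $\mathcal{B}(r)=\{z\in\mathbb{R}^n : \|z\|\le r\}$. Setting (infinite-horizon linear-quadratic cooperative differential game): $\mathsf N=\{1,\dots,N\}$ is the set of players. The data are $A\in\mathbb{R}^{n\times n}$, $B_i\in\mathbb{R}^{n\times m_i}$, $C_i\in\mathbb{R}^{s_i\times n}$ with $\mathrm{rank}(C_i)=s_i\le n$, $Q_i\in\mathbb{R}^{s_i\times s_i}$ with $Q_i\succeq0$, and $R_i\in\mathbb{R}^{m_i\times m_i}$ with $R_i\succ0$, $i\in\mathsf N$. Player $i$ observes only $y_i=C_ix$ and uses static output feedback $u_i=F_iy_i$. Let $m=m_1+\cdots+m_N$ and $B=[B_1\ B_2\ \cdots\ B_N]\in\mathbb{R}^{n\times m}$; $(A,B)$ is assumed stabilizable. Let $G_i=[0_{m_i\times m_1}\ \cdots\ I_{m_i}\ \cdots\ 0_{m_i\times m_N}]\in\mathbb{R}^{m_i\times m}$ (identity in the $i$-th block). Weights: $\mathcal{A}=\{\alpha=(\alpha_1,\dots,\alpha_N) : \alpha_i\in(0,1),\ \sum_{i\in\mathsf N}\alpha_i=1\}$. For $\alpha\in\mathcal{A}$ let $Q_\alpha=\sum_{i\in\mathsf N}C_i'(\alpha_iQ_i)C_i$ and $R_\alpha=\oplus_{i\in\mathsf N}\alpha_iR_i\in\mathbb{R}^{m\times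 m}$. Cost: for $F\in\mathbb{R}^{m\times n}$ and an initial condition $z\in\mathbb{R}^n$, let $x(t)$ solve $\dot x=(A+BF)x$, $x(0)=z$, let $u(t)=Fx(t)$, and let $J_\alpha(z,F)=\int_0^\infty (x(t)'Q_\alpha x(t)+u(t)'R_\alpha u(t))\,dt$. Structural condition SC$_2$: $F\in\mathbb{R}^{m\times n}$ satisfies SC$_2$ (is structured) if $G_iF\bigl(I_n-C_i'(C_iC_i')^{-1}C_i\bigr)=0$ for all $i\in\mathsf N$. Guaranteed cost problem under consideration: given $r>0$, $\alpha\in\mathcal{A}$, $\delta>0$, find $F_{\mathrm s}\in\mathbb{R}^{m\times n}$ satisfying SC$_2$ with $J_\alpha(z,F_{\mathrm s})<\delta$ for all $z\in\mathcal{B}(r)$ and $A+BF_{\mathrm s}$ Hurwitz. For $\delta>0$ and $\alpha\in\mathcal{A}$: $\hat{\mathfrak g}_\alpha(\delta)$ is the set of all $F\in\mathbb{R}^{m\times n}$ that satisfy SC$_2$ and $J_\alpha(z,F)<\delta$ for all initial conditions $z\in\mathcal{B}(r)$; its elements are called (feedback) guaranteed cost structured controls, and such an $F$ is called stabilizing if $A+BF$ is Hurwitz.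
   Formalization: The conditions are required for every initial condition x_0 in B(r) (with P_α allowed to depend on x_0), since for one fixed x_0, e.g. x_0 = 0, the claimed cost bound on all of B(r) is false. *)

theory Defs
  imports
    "HOL-Analysis.Analysis"
    "Jordan_Normal_Form.DL_Rank"
    "Jordan_Normal_Form.Gauss_Jordan_Elimination"
    "Jordan_Normal_Form.Char_Poly"
begin

(* Matrices whose sizes depend on the player are taken from Jordan_Normal_Form,
   so $ denotes vec_index below. Players are 1, ..., N. *)
unbundle no vec_syntax

section \<open>Matrix notions\<close>

(* Definiteness is understood for symmetric matrices only. *)
definition pos_def :: "nat \<Rightarrow> real mat \<Rightarrow> bool" where
  "pos_def n M \<longleftrightarrow> M \<in> carrier_mat n n \<and> transpose_mat M = M \<and>
     (\<forall>v \<in> carrier_vec n. v \<noteq> 0\<^sub>v n \<longrightarrow> scalar_prod v (M *\<^sub>v v) > 0)"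

definition pos_semidef :: "nat \<Rightarrow> real mat \<Rightarrow> bool" where
  "pos_semidef n M \<longleftrightarrow> M \<in> carrier_mat n n \<and> transpose_mat M = M \<and>
     (\<forall>v \<in> carrier_vec n. scalar_prod v (M *\<^sub>v v) \<ge> 0)"

definition neg_def :: "nat \<Rightarrow> real mat \<Rightarrow> bool" where
  "neg_def n M \<longleftrightarrow> M \<in> carrier_mat n n \<and> transpose_mat M = M \<and>
     (\<forall>v \<in> carrier_vec n. v \<noteq> 0\<^sub>v n \<longrightarrow> scalar_prod v (M *\<^sub>v v) < 0)"

definition hurwitz :: "real mat \<Rightarrow> bool" where
  "hurwitz M \<longleftrightarrow> (\<forall>k. eigenvalue (map_mat complex_of_real M) k \<longrightarrow> Re k < 0)"

definition stabilizable :: "nat \<Rightarrow> nat \<Rightarrow> real mat \<Rightarrow> real mat \<Rightarrow> bool" where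
  "stabilizable n m A B \<longleftrightarrow> (\<exists>K \<in> carrier_mat m n. hurwitz (A + B * K))"

definition norm_ball :: "nat \<Rightarrow> real \<Rightarrow> real vec set" where
  "norm_ball n r = {z \<in> carrier_vec n. sqrt (scalar_prod z z) \<le> r}"

(* [M1 M2 ...] for matrices with n rows; the lower blocks of four_block_mat have no rows. *)
fun hcat_mat :: "nat \<Rightarrow> real mat list \<Rightarrow> real mat" where
  "hcat_mat n [] = 0\<^sub>m n 0"
| "hcat_mat n (M # Ms) =
     four_block_mat M (hcat_mat n Ms) (0\<^sub>m 0 (dim_col M)) (0\<^sub>m 0 (dim_col (hcat_mat n Ms)))"


section \<open>Data of the game\<close>

definition total_dim :: "nat \<Rightarrow> (nat \<Rightarrow> nat) \<Rightarrow> nat" where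
  "total_dim N m = (\<Sum>i\<in>{1..N}. m i)"

definition joint_input :: "nat \<Rightarrow> nat \<Rightarrow> (nat \<Rightarrow> real mat) \<Rightarrow> real mat" where
  "joint_input N n B = hcat_mat n (map B [1..<Suc N])"

definition block_selector :: "nat \<Rightarrow> (nat \<Rightarrow> nat) \<Rightarrow> nat \<Rightarrow> real mat" where
  "block_selector N m i =
     hcat_mat (m i) (map (\<lambda>j. if j = i then 1\<^sub>m (m i) else 0\<^sub>m (m i) (m j)) [1..<Suc N])"

definition lq_game ::
  "nat \<Rightarrow> nat \<Rightarrow> (nat \<Rightarrow> nat) \<Rightarrow> (nat \<Rightarrow> nat) \<Rightarrow> real mat \<Rightarrow> (nat \<Rightarrow> real mat) \<Rightarrow>
   (nat \<Rightarrow> real mat) \<Rightarrow> (nat \<Rightarrow> real mat) \<Rightarrow> (nat \<Rightarrow> real mat) \<Rightarrow> bool" where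
  "lq_game N n m s A B C Q R \<longleftrightarrow>
     A \<in> carrier_mat n n \<and>
     (\<forall>i\<in>{1..N}.
        B i \<in> carrier_mat n (m i) \<and>
        C i \<in> carrier_mat (s i) n \<and> vec_space.rank (s i) (C i) = s i \<and> s i \<le> n \<and>
        pos_semidef (s i) (Q i) \<and>
        pos_def (m i) (R i)) \<and>
     stabilizable n (total_dim N m) A (joint_input N n B)"

definition weights :: "nat \<Rightarrow> (nat \<Rightarrow> real) set" where
  "weights N = {\<alpha>. (\<forall>i\<in>{1..N}. 0 < \<alpha> i \<and> \<alpha> i < 1) \<and> (\<Sum>i\<in>{1..N}. \<alpha> i) = 1}"

definition weighted_Q ::
  "nat \<Rightarrow> nat \<Rightarrow> (nat \<Rightarrow> real mat) \<Rightarrow> (nat \<Rightarrow> real mat) \<Rightarrow> (nat \<Rightarrow> real) \<Rightarrow> real mat" where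
  "weighted_Q N n C Q \<alpha> =
     mat n n (\<lambda>kl. \<Sum>i\<in>{1..N}. (transpose_mat (C i) * (\<alpha> i \<cdot>\<^sub>m Q i) * C i) $$ kl)"

definition weighted_R :: "nat \<Rightarrow> (nat \<Rightarrow> real mat) \<Rightarrow> (nat \<Rightarrow> real) \<Rightarrow> real mat" where
  "weighted_R N R \<alpha> = diag_block_mat (map (\<lambda>i. \<alpha> i \<cdot>\<^sub>m R i) [1..<Suc N])"


section \<open>Cost and guaranteed cost structured controls\<close>

definition solves_lin_ode :: "nat \<Rightarrow> real mat \<Rightarrow> real vec \<Rightarrow> (real \<Rightarrow> real vec) \<Rightarrow> bool" where
  "solves_lin_ode n M z x \<longleftrightarrow>
     x 0 = z \<and>
     (\<forall>t\<ge>0. x t \<in> carrier_vec n \<and>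
        (\<forall>i<n. ((\<lambda>\<tau>. x \<tau> $ i) has_real_derivative (M *\<^sub>v x t) $ i) (at t within {0..})))"

(* A solution exists and is unique on {0..}; its values at negative times are never used. *)
definition trajectory :: "nat \<Rightarrow> real mat \<Rightarrow> real vec \<Rightarrow> real \<Rightarrow> real vec" where
  "trajectory n M z = (SOME x. solves_lin_ode n M z x)"

(* The integrand is nonnegative for positive semidefinite Q and R; taking the integral
   in ennreal makes a divergent cost infinite. *)
definition cost ::
  "nat \<Rightarrow> real mat \<Rightarrow> real mat \<Rightarrow> real mat \<Rightarrow> real mat \<Rightarrow> real vec \<Rightarrow> real mat \<Rightarrow> ennreal" where
  "cost n A B Q R z F =
     (let x = trajectory n (A + B * F) z; u = (\<lambda>t. F *\<^sub>v x t)
      in \<integral>\<^sup>+ t \<in> {0..}. ennreal (scalar_prod (x t) (Q *\<^sub>v x t) + scalar_prod (u t) (R *\<^sub>v u t)) \<partial>lborel)"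

(* mat_inverse (C_i C_i') is Some because C_i has full row rank. *)
definition structured ::
  "nat \<Rightarrow> nat \<Rightarrow> (nat \<Rightarrow> nat) \<Rightarrow> (nat \<Rightarrow> real mat) \<Rightarrow> real mat \<Rightarrow> bool" where
  "structured N n m C F \<longleftrightarrow>
     (\<forall>i\<in>{1..N}.
        block_selector N m i * F *
          (1\<^sub>m n - transpose_mat (C i) * the (mat_inverse (C i * transpose_mat (C i))) * C i)
        = 0\<^sub>m (m i) n)"

definition guaranteed_cost_structured ::
  "nat \<Rightarrow> nat \<Rightarrow> (nat \<Rightarrow> nat) \<Rightarrow> real mat \<Rightarrow> (nat \<Rightarrow> real mat) \<Rightarrow> (nat \<Rightarrow> real mat) \<Rightarrow>
   (nat \<Rightarrow> real mat) \<Rightarrow> (nat \<Rightarrow> real mat) \<Rightarrow> real \<Rightarrow> (nat \<Rightarrow> real) \<Rightarrow> real \<Rightarrow> real mat set" where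
  "guaranteed_cost_structured N n m A B C Q R r \<alpha> \<delta> =
     {F \<in> carrier_mat (total_dim N m) n.
        structured N n m C F \<and>
        (\<forall>z \<in> norm_ball n r.
           cost n A (joint_input N n B) (weighted_Q N n C Q \<alpha>) (weighted_R N R \<alpha>) z F
             < ennreal \<delta>)}"

end

theory Submission
  imports Defs
begin

text \<open>
  The matrix inequality is a Lyapunov certificate that does two jobs at once. Write
  \<open>M\<close> for the closed-loop matrix and \<open>V(x) = x' P x\<close>. Along a solution of
  \<open>dx/dt = M x\<close> the derivative of \<open>V\<close> is \<open>x' (M' P + P M) x\<close>, and the inequality says that this
  is at most \<open>-(x' Q\<^sub>\<alpha> x + u' R\<^sub>\<alpha> u)\<close> with \<open>u = F\<^sub>s x\<close>: the stored quantity \<open>V\<close> falls at least as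
  fast as cost accrues. Since \<open>V\<close> never becomes negative, the total cost is at most its
  initial value \<open>x\<^sub>0' P x\<^sub>0 < \<delta>\<close> (\<open>dissipation_nn_integral_le\<close>, \<open>cost_le_quadratic_form\<close>).

  The running cost itself is nonnegative, because all \<open>Q\<^sub>i\<close> and \<open>R\<^sub>i\<close> are at least positive
  semidefinite and the weights are positive. Hence \<open>M' P + P M\<close> is itself negative definite.
  Testing it against the real and imaginary parts of a complex eigenvector, where the
  two values of its form add up to \<open>2 Re k\<close> times a positive number, shows that every eigenvalue \<open>k\<close> has
  negative real part (\<open>lyapunov_imp_hurwitz\<close>). The certificate \<open>P\<close> may change with the initial
  state; the one that belongs to the origin serves for stability.

  The cost is defined through an arbitrarily chosen solution of the closed-loop equation,
  so the bound says something only once a solution is known to exist; this is the purpose of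
  the power series construction in \<open>ex_solves_lin_ode\<close>.
\<close>

section \<open>Quadratic forms\<close>

lemma mult_mat_vec_sum:
  assumes "M \<in> carrier_mat n k" "x \<in> carrier_vec k" "i < n"
  shows "(M *\<^sub>v x) $ i = (\<Sum>j<k. M $$ (i, j) * x $ j)"
  using assms by (auto simp: scalar_prod_def lessThan_atLeast0 intro!: sum.cong)

lemma scalar_prod_sum:
  assumes "y \<in> carrier_vec n"
  shows "scalar_prod x y = (\<Sum>i<n. x $ i * y $ i)"
  using assms by (auto simp: scalar_prod_def lessThan_atLeast0)

lemma scalar_prod_smult_mat:
  fixes M :: "real mat"
  assumes M: "M \<in> carrier_mat n n" and v: "v \<in> carrier_vec n"
  shows "scalar_prod v ((a \<cdot>\<^sub>m M) *\<^sub>v v) = a * scalar_prod v (M *\<^sub>v v)"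
proof -
  have aM: "a \<cdot>\<^sub>m M \<in> carrier_mat n n" using M by simp
  have "((a \<cdot>\<^sub>m M) *\<^sub>v v) $ i = a * (M *\<^sub>v v) $ i" if "i < n" for i
    unfolding mult_mat_vec_sum[OF aM v that] mult_mat_vec_sum[OF M v that]
    using M that by (simp add: sum_distrib_left mult.assoc)
  then show ?thesis
    unfolding scalar_prod_sum[OF mult_mat_vec_carrier[OF aM v]]
      scalar_prod_sum[OF mult_mat_vec_carrier[OF M v]]
    by (simp add: sum_distrib_left mult.left_commute)
qed

lemma scalar_prod_mult_congruence:
  fixes S :: "real mat"
  assumes S: "S \<in> carrier_mat m m" and F: "F \<in> carrier_mat m n" and x: "x \<in> carrier_vec n"
  shows "scalar_prod x ((transpose_mat F * S * F) *\<^sub>v x)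
    = scalar_prod (F *\<^sub>v x) (S *\<^sub>v (F *\<^sub>v x))"
proof -
  have Fx: "F *\<^sub>v x \<in> carrier_vec m" using F x by simp
  then have SFx: "S *\<^sub>v (F *\<^sub>v x) \<in> carrier_vec m" using S by simp
  then have TSFx: "transpose_mat F *\<^sub>v (S *\<^sub>v (F *\<^sub>v x)) \<in> carrier_vec n" using F by simp
  have "(transpose_mat F * S * F) *\<^sub>v x = (transpose_mat F * S) *\<^sub>v (F *\<^sub>v x)"
    using S F x by (intro assoc_mult_mat_vec[of _ n m]) auto
  also have "\<dots> = transpose_mat F *\<^sub>v (S *\<^sub>v (F *\<^sub>v x))"
    using S F Fx by (intro assoc_mult_mat_vec[of _ n m]) auto
  finally show ?thesis
    using transpose_vec_mult_scalar[OF F x SFx] comm_scalar_prod[OF x TSFx]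
      comm_scalar_prod[OF Fx SFx] by simp
qed

text \<open>The right side is the product-rule derivative of \<open>x' P x\<close> in the direction \<open>M x\<close>, so the
Lyapunov operator \<open>M' P + P M\<close> represents the rate of change of \<open>x' P x\<close>.\<close>

lemma scalar_prod_lyapunov:
  fixes M P :: "real mat"
  assumes M: "M \<in> carrier_mat n n" and P: "P \<in> carrier_mat n n" and x: "x \<in> carrier_vec n"
  shows "scalar_prod x ((transpose_mat M * P + P * M) *\<^sub>v x)
    = scalar_prod (M *\<^sub>v x) (P *\<^sub>v x) + scalar_prod x (P *\<^sub>v (M *\<^sub>v x))"
proof -
  have Px: "P *\<^sub>v x \<in> carrier_vec n" and Mx: "M *\<^sub>v x \<in> carrier_vec n"
    and MPx: "transpose_mat M *\<^sub>v (P *\<^sub>v x) \<in> carrier_vec n"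
    and PMx: "P *\<^sub>v (M *\<^sub>v x) \<in> carrier_vec n"
    using M P x by auto
  have "(transpose_mat M * P + P * M) *\<^sub>v x
      = transpose_mat M *\<^sub>v (P *\<^sub>v x) + P *\<^sub>v (M *\<^sub>v x)"
    using M P x by (subst add_mult_distrib_mat_vec[of _ n n]) auto
  then have "scalar_prod x ((transpose_mat M * P + P * M) *\<^sub>v x)
      = scalar_prod x (transpose_mat M *\<^sub>v (P *\<^sub>v x)) + scalar_prod x (P *\<^sub>v (M *\<^sub>v x))"
    using scalar_prod_add_distrib[OF x MPx PMx] by simp
  also have "scalar_prod x (transpose_mat M *\<^sub>v (P *\<^sub>v x)) = scalar_prod (M *\<^sub>v x) (P *\<^sub>v x)"
    using transpose_vec_mult_scalar[OF M x Px] comm_scalar_prod[OF x MPx]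
      comm_scalar_prod[OF Mx Px] by simp
  finally show ?thesis .
qed

lemma scalar_prod_symmetric_mat:
  fixes P :: "real mat"
  assumes P: "P \<in> carrier_mat n n" "transpose_mat P = P"
    and x: "x \<in> carrier_vec n" and y: "y \<in> carrier_vec n"
  shows "scalar_prod x (P *\<^sub>v y) = scalar_prod y (P *\<^sub>v x)"
  using transpose_vec_mult_scalar[OF P(1) x y] P(2)
    comm_scalar_prod[OF x mult_mat_vec_carrier[OF P(1) y]] by simp

section \<open>Nonnegativity of the running cost\<close>

text \<open>A vector splits along the blocks and the off-diagonal blocks vanish, so the form of the
direct sum is the sum of the forms of its summands.\<close>

lemma scalar_prod_diag_block_mat_nonneg:
  fixes Ms :: "real mat list"
  assumes "\<And>M. M \<in> set Ms \<Longrightarrow> square_mat M"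
    and "\<And>M v. M \<in> set Ms \<Longrightarrow> v \<in> carrier_vec (dim_row M) \<Longrightarrow> scalar_prod v (M *\<^sub>v v) \<ge> 0"
    and "v \<in> carrier_vec (dim_row (diag_block_mat Ms))"
  shows "scalar_prod v (diag_block_mat Ms *\<^sub>v v) \<ge> 0"
  using assms
proof (induction Ms arbitrary: v)
  case Nil
  then show ?case by (simp add: scalar_prod_def)
next
  case (Cons M Ms)
  define D where "D = diag_block_mat Ms"
  define k l where "k = dim_row M" and "l = dim_row D"
  have M: "M \<in> carrier_mat k k" using Cons.prems(1)[of M] by (auto simp: k_def)
  have "square_mat D"
    unfolding D_def by (rule diag_block_mat_square) (use Cons.prems(1) in auto)
  then have D: "D \<in> carrier_mat l l" by (auto simp: l_def)
  have DM: "diag_block_mat (M # Ms) = four_block_mat M (0\<^sub>m k l) (0\<^sub>m l k) D"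
    using M D by (simp add: D_def[symmetric] Let_def)
  define a d where "a = vec_first v k" and "d = vec_last v l"
  have a: "a \<in> carrier_vec k" and d: "d \<in> carrier_vec l" by (simp_all add: a_def d_def)
  have "v \<in> carrier_vec (k + l)" using Cons.prems(3) M D unfolding DM by simp
  then have v: "v = a @\<^sub>v d" by (simp add: a_def d_def)
  have "scalar_prod v (diag_block_mat (M # Ms) *\<^sub>v v)
      = scalar_prod a (M *\<^sub>v a) + scalar_prod d (D *\<^sub>v d)"
    unfolding DM v mult_mat_vec_split[OF M D a d]
    using M D a d by (intro scalar_prod_append) auto
  moreover have "scalar_prod a (M *\<^sub>v a) \<ge> 0"
    using Cons.prems(2) a by (simp add: k_def)
  moreover have "scalar_prod d (D *\<^sub>v d) \<ge> 0"
    using Cons.IH Cons.prems(1,2) d by (simp add: D_def l_def)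
  ultimately show ?case by simp
qed

lemma scalar_prod_weighted_R_nonneg:
  assumes R: "\<And>i. i \<in> {1..N} \<Longrightarrow> pos_def (m i) (R i)"
    and \<alpha>: "\<alpha> \<in> weights N" and v: "v \<in> carrier_vec (dim_row (weighted_R N R \<alpha>))"
  shows "scalar_prod v (weighted_R N R \<alpha> *\<^sub>v v) \<ge> 0"
  unfolding weighted_R_def
proof (rule scalar_prod_diag_block_mat_nonneg)
  fix M assume "M \<in> set (map (\<lambda>i. \<alpha> i \<cdot>\<^sub>m R i) [1..<Suc N])"
  then have "M \<in> (\<lambda>i. \<alpha> i \<cdot>\<^sub>m R i) ` {1..N}" by (auto simp del: upt_Suc)
  then obtain i where i: "i \<in> {1..N}" and M: "M = \<alpha> i \<cdot>\<^sub>m R i" by blast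
  from R[OF i] have Ri: "R i \<in> carrier_mat (m i) (m i)" by (simp add: pos_def_def)
  show "square_mat M" using Ri by (auto simp: M)
  fix v :: "real vec" assume "v \<in> carrier_vec (dim_row M)"
  then have v: "v \<in> carrier_vec (m i)" using Ri by (simp add: M)
  have "scalar_prod v (R i *\<^sub>v v) \<ge> 0"
    using R[OF i] v Ri by (cases "v = 0\<^sub>v (m i)") (auto simp: pos_def_def less_imp_le)
  then show "scalar_prod v (M *\<^sub>v v) \<ge> 0"
    unfolding M scalar_prod_smult_mat[OF Ri v] using \<alpha> i by (simp add: weights_def less_imp_le)
qed (use v in \<open>simp add: weighted_R_def\<close>)

lemma weighted_R_carrier:
  assumes "\<And>i. i \<in> {1..N} \<Longrightarrow> R i \<in> carrier_mat (m i) (m i)"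
  shows "weighted_R N R \<alpha> \<in> carrier_mat (total_dim N m) (total_dim N m)"
proof -
  have "sum_list (map f [1..<Suc N]) = (\<Sum>i\<in>{1..N}. f i)" for f :: "nat \<Rightarrow> nat"
    by (simp add: interv_sum_list_conv_sum_set_nat atLeastLessThanSuc_atLeastAtMost del: upt_Suc)
  moreover have "(\<Sum>i\<in>{1..N}. dim_row (R i)) = (\<Sum>i\<in>{1..N}. m i)"
    "(\<Sum>i\<in>{1..N}. dim_col (R i)) = (\<Sum>i\<in>{1..N}. m i)"
    by (rule sum.cong[OF refl], use assms in blast)+
  ultimately have "sum_list (map dim_row (map (\<lambda>i. \<alpha> i \<cdot>\<^sub>m R i) [1..<Suc N])) = total_dim N m"
    "sum_list (map dim_col (map (\<lambda>i. \<alpha> i \<cdot>\<^sub>m R i) [1..<Suc N])) = total_dim N m"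
    by (simp_all add: total_dim_def comp_def del: upt_Suc)
  then show ?thesis by (auto simp: weighted_R_def dim_diag_block_mat simp del: upt_Suc)
qed

text \<open>Each summand contributes \<open>\<alpha>\<^sub>i y\<^sub>i' Q\<^sub>i y\<^sub>i\<close>, where \<open>y\<^sub>i = C\<^sub>i v\<close> is the output that player \<open>i\<close> observes.\<close>

lemma scalar_prod_weighted_Q_nonneg:
  assumes C: "\<And>i. i \<in> {1..N} \<Longrightarrow> C i \<in> carrier_mat (s i) n"
    and Q: "\<And>i. i \<in> {1..N} \<Longrightarrow> pos_semidef (s i) (Q i)"
    and \<alpha>: "\<alpha> \<in> weights N" and v: "v \<in> carrier_vec n"
  shows "scalar_prod v (weighted_Q N n C Q \<alpha> *\<^sub>v v) \<ge> 0"
proof -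
  define X where "X i = transpose_mat (C i) * (\<alpha> i \<cdot>\<^sub>m Q i) * C i" for i
  have Qi: "Q i \<in> carrier_mat (s i) (s i)" if "i \<in> {1..N}" for i
    using Q[OF that] by (simp add: pos_semidef_def)
  have X: "X i \<in> carrier_mat n n" if "i \<in> {1..N}" for i
    using C[OF that] Qi[OF that] by (auto simp: X_def)
  have WQ: "weighted_Q N n C Q \<alpha> \<in> carrier_mat n n" by (simp add: weighted_Q_def)
  have expand: "scalar_prod v (Y *\<^sub>v v) = (\<Sum>k<n. \<Sum>l<n. v $ k * Y $$ (k, l) * v $ l)"
    if Y: "Y \<in> carrier_mat n n" for Y
    using scalar_prod_sum[OF mult_mat_vec_carrier[OF Y v]] mult_mat_vec_sum[OF Y v]
    by (simp add: sum_distrib_left mult.assoc)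
  have "scalar_prod v (weighted_Q N n C Q \<alpha> *\<^sub>v v)
      = (\<Sum>k<n. \<Sum>l<n. \<Sum>i\<in>{1..N}. v $ k * X i $$ (k, l) * v $ l)"
    unfolding expand[OF WQ]
    by (simp add: weighted_Q_def X_def sum_distrib_left sum_distrib_right)
  also have "\<dots> = (\<Sum>i\<in>{1..N}. \<Sum>k<n. \<Sum>l<n. v $ k * X i $$ (k, l) * v $ l)"
    by (simp only: sum.swap[of _ "{1..N}" "{..<n}"])
  also have "\<dots> = (\<Sum>i\<in>{1..N}. scalar_prod v (X i *\<^sub>v v))"
    by (rule sum.cong) (simp_all add: expand X)
  also have "\<dots> \<ge> 0"
  proof (rule sum_nonneg)
    fix i assume i: "i \<in> {1..N}"
    have Cv: "C i *\<^sub>v v \<in> carrier_vec (s i)" using C[OF i] v by simp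
    have "scalar_prod v (X i *\<^sub>v v) = scalar_prod (C i *\<^sub>v v) ((\<alpha> i \<cdot>\<^sub>m Q i) *\<^sub>v (C i *\<^sub>v v))"
      unfolding X_def using C[OF i] Qi[OF i] v by (intro scalar_prod_mult_congruence) auto
    also have "\<dots> = \<alpha> i * scalar_prod (C i *\<^sub>v v) (Q i *\<^sub>v (C i *\<^sub>v v))"
      by (rule scalar_prod_smult_mat[OF Qi[OF i] Cv])
    also have "\<dots> \<ge> 0"
      using \<alpha> i Q[OF i] Cv by (simp add: weights_def pos_semidef_def less_imp_le)
    finally show "scalar_prod v (X i *\<^sub>v v) \<ge> 0" .
  qed
  finally show ?thesis .
qed

section \<open>Lyapunov's criterion for eigenvalues\<close>

text \<open>If \<open>M (a + i b) = k (a + i b)\<close> with \<open>a\<close>, \<open>b\<close> real, add the values of the form of \<open>M' P + P M\<close>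
at \<open>a\<close> and at \<open>b\<close>. The contributions of the imaginary part of \<open>k\<close> cancel because \<open>P\<close> is
symmetric, and what remains is \<open>2 Re k (a' P a + b' P b)\<close>. The sum is negative and the bracket
positive, as \<open>a\<close> and \<open>b\<close> are not both zero. Working with \<open>a\<close> and \<open>b\<close> keeps the
definiteness notions real.\<close>

lemma lyapunov_imp_hurwitz:
  fixes M P :: "real mat"
  assumes M: "M \<in> carrier_mat n n" and P: "pos_def n P"
    and lyap: "\<And>v. v \<in> carrier_vec n \<Longrightarrow> v \<noteq> 0\<^sub>v n \<Longrightarrow>
      scalar_prod v ((transpose_mat M * P + P * M) *\<^sub>v v) < 0"
  shows "hurwitz M"
  unfolding hurwitz_def
proof (intro allI impI)
  fix k assume "eigenvalue (map_mat complex_of_real M) k"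
  then obtain v where v: "v \<in> carrier_vec n" "v \<noteq> 0\<^sub>v n"
    and eig: "map_mat complex_of_real M *\<^sub>v v = k \<cdot>\<^sub>v v"
    using M by (auto simp: eigenvalue_def eigenvector_def)
  have Pc: "P \<in> carrier_mat n n" and Pt: "transpose_mat P = P"
    and Ppos: "\<And>v. v \<in> carrier_vec n \<Longrightarrow> v \<noteq> 0\<^sub>v n \<Longrightarrow> scalar_prod v (P *\<^sub>v v) > 0"
    using P by (auto simp: pos_def_def)
  define a b where "a = map_vec Re v" and "b = map_vec Im v"
  have a: "a \<in> carrier_vec n" and b: "b \<in> carrier_vec n"
    using v by (auto simp: a_def b_def)
  have comp: "(\<Sum>j<n. complex_of_real (M $$ (i, j)) * v $ j) = k * v $ i" if "i < n" for i
    using mult_mat_vec_sum[of "map_mat complex_of_real M" n n v i] eig v(1) M that by simp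
  have Ma: "M *\<^sub>v a = Re k \<cdot>\<^sub>v a - Im k \<cdot>\<^sub>v b"
  proof (intro eq_vecI)
    fix i assume "i < dim_vec (Re k \<cdot>\<^sub>v a - Im k \<cdot>\<^sub>v b)"
    then have i: "i < n" using a b by simp
    have "(M *\<^sub>v a) $ i = Re (\<Sum>j<n. complex_of_real (M $$ (i, j)) * v $ j)"
      using mult_mat_vec_sum[OF M a i] v by (simp add: a_def)
    with comp[OF i] show "(M *\<^sub>v a) $ i = (Re k \<cdot>\<^sub>v a - Im k \<cdot>\<^sub>v b) $ i"
      using i a b v by (simp add: a_def b_def)
  qed (use M a b in simp)
  have Mb: "M *\<^sub>v b = Im k \<cdot>\<^sub>v a + Re k \<cdot>\<^sub>v b"
  proof (intro eq_vecI)
    fix i assume "i < dim_vec (Im k \<cdot>\<^sub>v a + Re k \<cdot>\<^sub>v b)"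
    then have i: "i < n" using a b by simp
    have "(M *\<^sub>v b) $ i = Im (\<Sum>j<n. complex_of_real (M $$ (i, j)) * v $ j)"
      using mult_mat_vec_sum[OF M b i] v by (simp add: b_def)
    with comp[OF i] show "(M *\<^sub>v b) $ i = (Im k \<cdot>\<^sub>v a + Re k \<cdot>\<^sub>v b) $ i"
      using i a b v by (simp add: a_def b_def)
  qed (use M a b in simp)
  have Pa: "P *\<^sub>v a \<in> carrier_vec n" and Pb: "P *\<^sub>v b \<in> carrier_vec n" using Pc a b by auto
  have lyap_eq: "scalar_prod u ((transpose_mat M * P + P * M) *\<^sub>v u)
      = 2 * scalar_prod (M *\<^sub>v u) (P *\<^sub>v u)" if u: "u \<in> carrier_vec n" for u
    using scalar_prod_lyapunov[OF M Pc u] scalar_prod_symmetric_mat[OF Pc Pt u, of "M *\<^sub>v u"] M u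
    by simp
  have sym: "scalar_prod a (P *\<^sub>v b) = scalar_prod b (P *\<^sub>v a)"
    by (rule scalar_prod_symmetric_mat[OF Pc Pt a b])
  have "scalar_prod (M *\<^sub>v a) (P *\<^sub>v a) = Re k * scalar_prod a (P *\<^sub>v a) - Im k * scalar_prod b (P *\<^sub>v a)"
    unfolding Ma using a b Pa by (subst minus_scalar_prod_distrib[of _ n]) auto
  moreover have "scalar_prod (M *\<^sub>v b) (P *\<^sub>v b) = Im k * scalar_prod a (P *\<^sub>v b) + Re k * scalar_prod b (P *\<^sub>v b)"
    unfolding Mb using a b Pb by (subst add_scalar_prod_distrib[of _ n]) auto
  ultimately have eq: "scalar_prod a ((transpose_mat M * P + P * M) *\<^sub>v a)
        + scalar_prod b ((transpose_mat M * P + P * M) *\<^sub>v b)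
      = 2 * Re k * (scalar_prod a (P *\<^sub>v a) + scalar_prod b (P *\<^sub>v b))"
    unfolding lyap_eq[OF a] lyap_eq[OF b] sym by (simp add: algebra_simps)
  have le: "scalar_prod u ((transpose_mat M * P + P * M) *\<^sub>v u) \<le> 0"
      "scalar_prod u (P *\<^sub>v u) \<ge> 0" if u: "u \<in> carrier_vec n" for u
  proof -
    have "(transpose_mat M * P + P * M) *\<^sub>v u \<in> carrier_vec n" "P *\<^sub>v u \<in> carrier_vec n"
      using M Pc u by (auto intro!: mult_mat_vec_carrier[of _ n n])
    then show "scalar_prod u ((transpose_mat M * P + P * M) *\<^sub>v u) \<le> 0" "scalar_prod u (P *\<^sub>v u) \<ge> 0"
      using lyap[OF u] Ppos[OF u] by (cases "u = 0\<^sub>v n"; force)+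
  qed
  have "a \<noteq> 0\<^sub>v n \<or> b \<noteq> 0\<^sub>v n"
  proof (rule ccontr)
    assume "\<not> ?thesis"
    then have "a = 0\<^sub>v n" "b = 0\<^sub>v n" by auto
    then have "Re (v $ i) = 0 \<and> Im (v $ i) = 0" if "i < n" for i
      using v that unfolding a_def b_def by (metis carrier_vecD index_map_vec(1) index_zero_vec(1))
    then have "v = 0\<^sub>v n"
      using v(1) by (intro eq_vecI) (auto simp: complex_eq_iff)
    with v(2) show False ..
  qed
  then have "scalar_prod a ((transpose_mat M * P + P * M) *\<^sub>v a)
        + scalar_prod b ((transpose_mat M * P + P * M) *\<^sub>v b) < 0"
      and "scalar_prod a (P *\<^sub>v a) + scalar_prod b (P *\<^sub>v b) > 0"
    using lyap[OF a] lyap[OF b] Ppos[OF a] Ppos[OF b] le[OF a] le[OF b] by fastforce+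
  then show "Re k < 0"
    unfolding eq by (simp add: mult_less_0_iff)
qed

section \<open>Existence of trajectories\<close>

text \<open>The solution is the matrix exponential applied to \<open>z\<close>, written componentwise as the power
series with coefficients \<open>(M\<^sup>k z)\<^sub>i / k!\<close>. With \<open>L\<close> the sum of the absolute values of all entries of \<open>M\<close>,
the numbers \<open>(M\<^sup>k z)\<^sub>i\<close> grow at most like \<open>L\<^sup>k\<close>, so comparison with the exponential series gives
convergence everywhere, and differentiating term by term replaces \<open>M\<^sup>k z\<close> by \<open>M (M\<^sup>k z)\<close>.\<close>

lemma ex_solves_lin_ode:
  fixes M :: "real mat"
  assumes M: "M \<in> carrier_mat n n" and z: "z \<in> carrier_vec n"
  shows "\<exists>x. solves_lin_ode n M z x"
proof -
  define w where "w k = ((\<lambda>v. M *\<^sub>v v) ^^ k) z" for k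
  have w_carrier: "w k \<in> carrier_vec n" for k
    by (induction k) (auto simp: w_def z intro!: mult_mat_vec_carrier[OF M])
  have w_0: "w 0 = z" and w_Suc: "w (Suc k) = M *\<^sub>v w k" for k
    by (simp_all add: w_def)
  define L where "L = (\<Sum>i<n. \<Sum>j<n. \<bar>M $$ (i, j)\<bar>)"
  define K where "K = (\<Sum>i<n. \<bar>z $ i\<bar>)"
  have L: "(\<Sum>j<n. \<bar>M $$ (i, j)\<bar>) \<le> L" if "i < n" for i
    unfolding L_def using that
    by (intro member_le_sum[where f = "\<lambda>i. \<Sum>j<n. \<bar>M $$ (i, j)\<bar>"]) (auto intro: sum_nonneg)
  have L0: "L \<ge> 0" and K0: "K \<ge> 0"
    by (auto simp: L_def K_def intro!: sum_nonneg)
  have w_bound: "\<bar>w k $ i\<bar> \<le> K * L ^ k" if "i < n" for k i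
    using that
  proof (induction k arbitrary: i)
    case 0
    then show ?case
      unfolding K_def w_0 by (simp add: member_le_sum[where f = "\<lambda>i. \<bar>z $ i\<bar>"])
  next
    case (Suc k)
    have "\<bar>w (Suc k) $ i\<bar> \<le> (\<Sum>j<n. \<bar>M $$ (i, j)\<bar> * \<bar>w k $ j\<bar>)"
      unfolding w_Suc mult_mat_vec_sum[OF M w_carrier Suc.prems]
      by (rule order_trans[OF sum_abs]) (simp add: abs_mult)
    also have "\<dots> \<le> (\<Sum>j<n. \<bar>M $$ (i, j)\<bar> * (K * L ^ k))"
      by (intro sum_mono mult_left_mono Suc.IH) auto
    also have "\<dots> = (\<Sum>j<n. \<bar>M $$ (i, j)\<bar>) * (K * L ^ k)"
      by (simp add: sum_distrib_right)
    also have "\<dots> \<le> L * (K * L ^ k)"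
      using L[OF Suc.prems] K0 L0 by (intro mult_right_mono) auto
    finally show ?case by (simp add: algebra_simps)
  qed
  define c where "c i k = w k $ i / fact k" for i k
  have summ: "summable (\<lambda>k. c i k * t ^ k)" if "i < n" for i t
  proof (rule summable_comparison_test')
    show "summable (\<lambda>k. K * (inverse (fact k) * (L * \<bar>t\<bar>) ^ k))"
      by (intro summable_mult summable_exp)
    show "norm (c i k * t ^ k) \<le> K * (inverse (fact k) * (L * \<bar>t\<bar>) ^ k)" for k
      using w_bound[OF that, of k]
      by (simp add: c_def abs_mult power_abs power_mult_distrib divide_simps mult_right_mono
          mult.assoc[symmetric])
  qed
  define x where "x t = vec n (\<lambda>i. \<Sum>k. c i k * t ^ k)" for t
  have x_carrier: "x t \<in> carrier_vec n" for t by (simp add: x_def)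
  have x_deriv: "((\<lambda>\<tau>. x \<tau> $ i) has_real_derivative (M *\<^sub>v x t) $ i) (at t within {0..})"
    if i: "i < n" for i t
  proof -
    have "diffs (c i) k * t ^ k = (\<Sum>j<n. M $$ (i, j) * (c j k * t ^ k))" for k
    proof -
      have "diffs (c i) k = w (Suc k) $ i / fact k"
        by (simp add: diffs_def c_def fact_reduce)
      also have "\<dots> = (\<Sum>j<n. M $$ (i, j) * c j k)"
        unfolding w_Suc mult_mat_vec_sum[OF M w_carrier i] by (simp add: c_def sum_divide_distrib)
      finally show ?thesis by (simp add: sum_distrib_right mult.assoc)
    qed
    then have "(\<Sum>k. diffs (c i) k * t ^ k) = (\<Sum>k. \<Sum>j<n. M $$ (i, j) * (c j k * t ^ k))"
      by simp
    also have "\<dots> = (\<Sum>j<n. \<Sum>k. M $$ (i, j) * (c j k * t ^ k))"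
      by (rule suminf_sum) (auto intro: summable_mult summ)
    also have "\<dots> = (\<Sum>j<n. M $$ (i, j) * x t $ j)"
      by (intro sum.cong refl) (simp add: suminf_mult summ x_def)
    also have "\<dots> = (M *\<^sub>v x t) $ i"
      by (rule mult_mat_vec_sum[OF M x_carrier i, symmetric])
    finally have "(\<Sum>k. diffs (c i) k * t ^ k) = (M *\<^sub>v x t) $ i" .
    with termdiffs_strong_converges_everywhere[of "c i" t] summ[OF i] i
    show ?thesis by (simp add: x_def has_field_derivative_at_within)
  qed
  have c_0: "c i 0 = z $ i" for i by (simp add: c_def w_0)
  have "x 0 = z"
    using z by (intro eq_vecI) (auto simp: x_def c_0)
  with x_carrier x_deriv show ?thesis
    unfolding solves_lin_ode_def by blast
qed

lemma trajectory_solves: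
  assumes "M \<in> carrier_mat n n" "z \<in> carrier_vec n"
  shows "solves_lin_ode n M z (trajectory n M z)"
  unfolding trajectory_def using ex_solves_lin_ode[OF assms] by (rule someI_ex)

section \<open>Dissipation bound for the cost\<close>

lemma quadratic_form_has_derivative:
  fixes P M :: "real mat"
  assumes P: "P \<in> carrier_mat n n" and M: "M \<in> carrier_mat n n"
    and x: "solves_lin_ode n M z x" and t: "t \<ge> 0"
  shows "((\<lambda>t. scalar_prod (x t) (P *\<^sub>v x t)) has_real_derivative
      scalar_prod (x t) ((transpose_mat M * P + P * M) *\<^sub>v x t)) (at t within {0..})"
proof -
  have xc: "x \<tau> \<in> carrier_vec n" if "\<tau> \<ge> 0" for \<tau>
    using x that by (simp add: solves_lin_ode_def)
  have xd: "((\<lambda>\<tau>. x \<tau> $ i) has_real_derivative (M *\<^sub>v x t) $ i) (at t within {0..})" if "i < n" for i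
    using x t that by (simp add: solves_lin_ode_def)
  have expand: "scalar_prod u (P *\<^sub>v v) = (\<Sum>i<n. u $ i * (\<Sum>j<n. P $$ (i, j) * v $ j))"
    if "v \<in> carrier_vec n" for u v
    using scalar_prod_sum[OF mult_mat_vec_carrier[OF P that]] mult_mat_vec_sum[OF P that] by simp
  have Mx: "M *\<^sub>v x t \<in> carrier_vec n" using M xc[OF t] by simp
  have "((\<lambda>t. \<Sum>i<n. x t $ i * (\<Sum>j<n. P $$ (i, j) * x t $ j)) has_real_derivative
      (\<Sum>i<n. (M *\<^sub>v x t) $ i * (\<Sum>j<n. P $$ (i, j) * x t $ j)
        + (\<Sum>j<n. P $$ (i, j) * (M *\<^sub>v x t) $ j) * x t $ i)) (at t within {0..})"
    by (intro DERIV_sum DERIV_mult DERIV_cmult xd) auto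
  also have "(\<Sum>i<n. (M *\<^sub>v x t) $ i * (\<Sum>j<n. P $$ (i, j) * x t $ j)
        + (\<Sum>j<n. P $$ (i, j) * (M *\<^sub>v x t) $ j) * x t $ i)
      = scalar_prod (x t) ((transpose_mat M * P + P * M) *\<^sub>v x t)"
    unfolding scalar_prod_lyapunov[OF M P xc[OF t]] expand[OF xc[OF t]] expand[OF Mx]
    by (simp add: sum.distrib mult.commute)
  \<comment> \<open>The expanded form agrees with the original one only at nonnegative times, where \<open>x\<close> is known
    to have \<open>n\<close> components.\<close>
  finally show ?thesis
    by (rule has_field_derivative_transform_within[where d = 1]) (use t in \<open>auto simp: expand xc\<close>)
qed

text \<open>On \<open>[0, k]\<close> the integral of \<open>w\<close> is at most that of \<open>- V'\<close>, which is \<open>V 0 - V k \<le> V 0\<close>; then let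
\<open>k\<close> grow. Only the dominating function \<open>- V'\<close> is integrated exactly, by the fundamental theorem
of calculus.\<close>

lemma dissipation_nn_integral_le:
  fixes V V' w :: "real \<Rightarrow> real"
  assumes V: "\<And>t. t \<ge> 0 \<Longrightarrow> (V has_real_derivative V' t) (at t within {0..})"
    and V0: "\<And>t. t \<ge> 0 \<Longrightarrow> V t \<ge> 0"
    and w0: "\<And>t. t \<ge> 0 \<Longrightarrow> w t \<ge> 0"
    and wV: "\<And>t. t \<ge> 0 \<Longrightarrow> w t \<le> - V' t"
  shows "(\<integral>\<^sup>+ t \<in> {0..}. ennreal (w t) \<partial>lborel) \<le> ennreal (V 0)"
proof -
  \<comment> \<open>Gauge integrability of \<open>- V'\<close> yields Lebesgue measurability; monotone convergence is
    therefore applied in the completion of the measure, where the integrals have the same values.\<close>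
  define g where "g k t = ennreal (indicator {0..real k} t *\<^sub>R (- V' t))" for k t
  have I: "((\<lambda>t. - V' t) has_integral (V 0 - V (real k))) {0..real k}" for k
  proof -
    have "((\<lambda>t. V' t) has_integral (V (real k) - V 0)) {0..real k}"
      by (rule fundamental_theorem_of_calculus)
        (auto simp: has_real_derivative_iff_has_vector_derivative[symmetric]
          intro: DERIV_subset[OF V])
    from has_integral_neg[OF this] show ?thesis by simp
  qed
  have d0: "- V' t \<ge> 0" if "t \<ge> 0" for t
    using w0[OF that] wV[OF that] by linarith
  have g_int: "integral\<^sup>N lebesgue (g k) \<le> ennreal (V 0)" for k
  proof -
    have "integral\<^sup>N lebesgue (g k) = ennreal (V 0 - V (real k))"
      unfolding nn_integral_completion
      using nn_integral_has_integral_lebesgue[OF _ I[of k]] d0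
      by (simp add: g_def[abs_def])
    also have "\<dots> \<le> ennreal (V 0)"
      using V0[of "real k"] by (intro ennreal_leI) simp
    finally show ?thesis .
  qed
  have "incseq g"
    unfolding incseq_def le_fun_def g_def using d0
    by (auto simp: indicator_def intro!: ennreal_leI)
  moreover have "g k \<in> borel_measurable lebesgue" for k
    using has_integral_implies_lebesgue_measurable[OF I[of k]]
    unfolding g_def by measurable
  ultimately have SUP: "(\<integral>\<^sup>+ t. (SUP k. g k t) \<partial>lebesgue) = (SUP k. integral\<^sup>N lebesgue (g k))"
    by (rule nn_integral_monotone_convergence_SUP)
  have "(\<integral>\<^sup>+ t \<in> {0..}. ennreal (w t) \<partial>lborel) = (\<integral>\<^sup>+ t \<in> {0..}. ennreal (w t) \<partial>lebesgue)"
    by (rule nn_integral_completion[symmetric])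
  also have "\<dots> \<le> (\<integral>\<^sup>+ t. (SUP k. g k t) \<partial>lebesgue)"
  proof (rule nn_integral_mono)
    fix t :: real
    show "ennreal (w t) * indicator {0..} t \<le> (SUP k. g k t)"
    proof (cases "t \<ge> 0")
      case True
      obtain k where "t \<le> real k" using real_arch_simple by blast
      then have "ennreal (w t) * indicator {0..} t \<le> g k t"
        using True wV[OF True] by (auto simp: g_def intro!: ennreal_leI)
      also have "\<dots> \<le> (SUP k. g k t)" by (rule SUP_upper) simp
      finally show ?thesis .
    qed simp
  qed
  also have "\<dots> \<le> ennreal (V 0)"
    unfolding SUP by (rule SUP_least) (rule g_int)
  finally show ?thesis .
qed

text \<open>The form of \<open>P\<close> is a storage function for the closed loop with the running cost as dissipation
rate. This holds along every solution, whichever one the cost refers to.\<close>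

lemma cost_le_quadratic_form:
  fixes A B M P F Q R :: "real mat"
  defines "M \<equiv> A + B * F"
  assumes M: "M \<in> carrier_mat n n" and z: "z \<in> carrier_vec n"
    and P: "pos_def n P"
    and lyap: "\<And>v. v \<in> carrier_vec n \<Longrightarrow>
      scalar_prod v (Q *\<^sub>v v) + scalar_prod (F *\<^sub>v v) (R *\<^sub>v (F *\<^sub>v v))
        \<le> - scalar_prod v ((transpose_mat M * P + P * M) *\<^sub>v v)"
    and nonneg: "\<And>v. v \<in> carrier_vec n \<Longrightarrow>
      scalar_prod v (Q *\<^sub>v v) + scalar_prod (F *\<^sub>v v) (R *\<^sub>v (F *\<^sub>v v)) \<ge> 0"
  shows "cost n A B Q R z F \<le> ennreal (scalar_prod z (P *\<^sub>v z))"
proof -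
  define x where "x = trajectory n M z"
  have x: "solves_lin_ode n M z x"
    unfolding x_def by (rule trajectory_solves[OF M z])
  then have x0: "x 0 = z" and xc: "\<And>t. t \<ge> 0 \<Longrightarrow> x t \<in> carrier_vec n"
    by (auto simp: solves_lin_ode_def)
  have Pc: "P \<in> carrier_mat n n" using P by (simp add: pos_def_def)
  have Pnn: "scalar_prod v (P *\<^sub>v v) \<ge> 0" if "v \<in> carrier_vec n" for v
    using P that mult_mat_vec_carrier[OF Pc that]
    by (cases "v = 0\<^sub>v n") (auto simp: pos_def_def less_imp_le)
  have "(\<integral>\<^sup>+ t \<in> {0..}. ennreal (scalar_prod (x t) (Q *\<^sub>v x t)
        + scalar_prod (F *\<^sub>v x t) (R *\<^sub>v (F *\<^sub>v x t))) \<partial>lborel)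
      \<le> ennreal (scalar_prod (x 0) (P *\<^sub>v x 0))"
    by (rule dissipation_nn_integral_le[OF quadratic_form_has_derivative[OF Pc M x]])
      (use Pnn lyap nonneg xc in auto)
  then show ?thesis
    by (simp add: cost_def Let_def x_def[symmetric] M_def[symmetric] x0)
qed

section \<open>Stabilizing guaranteed cost controls\<close>

theorem theorem2:
  fixes N n :: nat and m s :: "nat \<Rightarrow> nat"
    and A F\<^sub>s :: "real mat" and B C Q R :: "nat \<Rightarrow> real mat"
    and \<alpha> :: "nat \<Rightarrow> real" and r \<delta> :: real
  defines "A\<^sub>c\<^sub>l \<equiv> A + joint_input N n B * F\<^sub>s"
  assumes "lq_game N n m s A B C Q R"
    and "r > 0" and "\<delta> > 0" and "\<alpha> \<in> weights N"
    and "F\<^sub>s \<in> carrier_mat (total_dim N m) n" and "structured N n m C F\<^sub>s"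
    and "\<forall>x\<^sub>0 \<in> norm_ball n r. \<exists>P. pos_def n P \<and>
           neg_def n (transpose_mat A\<^sub>c\<^sub>l * P + P * A\<^sub>c\<^sub>l + weighted_Q N n C Q \<alpha>
                      + transpose_mat F\<^sub>s * weighted_R N R \<alpha> * F\<^sub>s) \<and>
           scalar_prod x\<^sub>0 (P *\<^sub>v x\<^sub>0) < \<delta>"
  shows "F\<^sub>s \<in> guaranteed_cost_structured N n m A B C Q R r \<alpha> \<delta> \<and> hurwitz A\<^sub>c\<^sub>l"
proof -
  define Q\<^sub>\<alpha> where "Q\<^sub>\<alpha> = weighted_Q N n C Q \<alpha>"
  define R\<^sub>\<alpha> where "R\<^sub>\<alpha> = weighted_R N R \<alpha>"
  note game = assms(2)[unfolded lq_game_def]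
  have Acl: "A\<^sub>c\<^sub>l \<in> carrier_mat n n"
  proof -
    have "dim_row (hcat_mat n Ms) = n" if "\<forall>M \<in> set Ms. dim_row M = n" for Ms
      using that by (induction Ms) auto
    moreover have "\<forall>M \<in> set (map B [1..<Suc N]). dim_row M = n" using game by auto
    ultimately have "dim_row (joint_input N n B) = n" unfolding joint_input_def by blast
    then show ?thesis using assms(6) by (auto simp: A\<^sub>c\<^sub>l_def)
  qed
  have Qc: "Q\<^sub>\<alpha> \<in> carrier_mat n n" by (simp add: Q\<^sub>\<alpha>_def weighted_Q_def)
  have Rc: "R\<^sub>\<alpha> \<in> carrier_mat (total_dim N m) (total_dim N m)"
    unfolding R\<^sub>\<alpha>_def by (rule weighted_R_carrier) (use game in \<open>auto simp: pos_def_def\<close>)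
  have Fv: "F\<^sub>s *\<^sub>v v \<in> carrier_vec (total_dim N m)" if "v \<in> carrier_vec n" for v
    using assms(6) that by simp
  have running: "scalar_prod v (Q\<^sub>\<alpha> *\<^sub>v v) + scalar_prod (F\<^sub>s *\<^sub>v v) (R\<^sub>\<alpha> *\<^sub>v (F\<^sub>s *\<^sub>v v)) \<ge> 0"
    if v: "v \<in> carrier_vec n" for v
  proof -
    have "scalar_prod v (Q\<^sub>\<alpha> *\<^sub>v v) \<ge> 0"
      unfolding Q\<^sub>\<alpha>_def
      by (rule scalar_prod_weighted_Q_nonneg[OF _ _ assms(5) v]) (use game in auto)
    moreover have "scalar_prod (F\<^sub>s *\<^sub>v v) (R\<^sub>\<alpha> *\<^sub>v (F\<^sub>s *\<^sub>v v)) \<ge> 0"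
      using Fv[OF v] Rc unfolding R\<^sub>\<alpha>_def
      by (intro scalar_prod_weighted_R_nonneg[OF _ assms(5)]) (use game in auto)
    ultimately show ?thesis by simp
  qed
  have lmi_form: "scalar_prod v ((transpose_mat A\<^sub>c\<^sub>l * P + P * A\<^sub>c\<^sub>l + Q\<^sub>\<alpha>
      + transpose_mat F\<^sub>s * R\<^sub>\<alpha> * F\<^sub>s) *\<^sub>v v)
      = scalar_prod v ((transpose_mat A\<^sub>c\<^sub>l * P + P * A\<^sub>c\<^sub>l) *\<^sub>v v)
        + (scalar_prod v (Q\<^sub>\<alpha> *\<^sub>v v) + scalar_prod (F\<^sub>s *\<^sub>v v) (R\<^sub>\<alpha> *\<^sub>v (F\<^sub>s *\<^sub>v v)))"
    if P: "pos_def n P" and v: "v \<in> carrier_vec n" for P v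
  proof -
    define X where "X = transpose_mat A\<^sub>c\<^sub>l * P + P * A\<^sub>c\<^sub>l"
    define S where "S = transpose_mat F\<^sub>s * R\<^sub>\<alpha> * F\<^sub>s"
    have Xc: "X \<in> carrier_mat n n" using Acl P by (auto simp: X_def pos_def_def)
    have Sc: "S \<in> carrier_mat n n" using assms(6) Rc by (auto simp: S_def)
    have "scalar_prod v ((X + Q\<^sub>\<alpha> + S) *\<^sub>v v)
        = scalar_prod v (X *\<^sub>v v) + scalar_prod v (Q\<^sub>\<alpha> *\<^sub>v v) + scalar_prod v (S *\<^sub>v v)"
      using Xc Qc Sc v
      by (simp add: add_mult_distrib_mat_vec[of _ n n] scalar_prod_add_distrib[of _ n])
    then show ?thesis
      using scalar_prod_mult_congruence[OF Rc assms(6) v] by (simp add: X_def S_def)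
  qed
  have "cost n A (joint_input N n B) Q\<^sub>\<alpha> R\<^sub>\<alpha> z F\<^sub>s < ennreal \<delta>" if z: "z \<in> norm_ball n r" for z
  proof -
    obtain P where P: "pos_def n P" and neg: "neg_def n (transpose_mat A\<^sub>c\<^sub>l * P + P * A\<^sub>c\<^sub>l + Q\<^sub>\<alpha>
          + transpose_mat F\<^sub>s * R\<^sub>\<alpha> * F\<^sub>s)" and small: "scalar_prod z (P *\<^sub>v z) < \<delta>"
      using assms(8) z unfolding Q\<^sub>\<alpha>_def R\<^sub>\<alpha>_def by blast
    have zc: "z \<in> carrier_vec n" using z by (simp add: norm_ball_def)
    have "cost n A (joint_input N n B) Q\<^sub>\<alpha> R\<^sub>\<alpha> z F\<^sub>s \<le> ennreal (scalar_prod z (P *\<^sub>v z))"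
    proof (rule cost_le_quadratic_form[OF Acl[unfolded A\<^sub>c\<^sub>l_def] zc P _ running],
        fold A\<^sub>c\<^sub>l_def)
      fix v :: "real vec" assume v: "v \<in> carrier_vec n"
      have "scalar_prod v ((transpose_mat A\<^sub>c\<^sub>l * P + P * A\<^sub>c\<^sub>l + Q\<^sub>\<alpha>
      + transpose_mat F\<^sub>s * R\<^sub>\<alpha> * F\<^sub>s) *\<^sub>v v) \<le> 0"
        using neg v mult_mat_vec_carrier[OF _ v] by (cases "v = 0\<^sub>v n") (auto simp: neg_def_def less_imp_le)
      then show "scalar_prod v (Q\<^sub>\<alpha> *\<^sub>v v) + scalar_prod (F\<^sub>s *\<^sub>v v) (R\<^sub>\<alpha> *\<^sub>v (F\<^sub>s *\<^sub>v v))
          \<le> - scalar_prod v ((transpose_mat A\<^sub>c\<^sub>l * P + P * A\<^sub>c\<^sub>l) *\<^sub>v v)"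
        unfolding lmi_form[OF P v] by linarith
    qed
    also have "\<dots> < ennreal \<delta>"
      using small assms(4) by (simp add: ennreal_less_iff ennreal_lessI)
    finally show ?thesis .
  qed
  moreover have "hurwitz A\<^sub>c\<^sub>l"
  proof -
    have "0\<^sub>v n \<in> norm_ball n r"
      using assms(3) by (simp add: norm_ball_def)
    then obtain P where P: "pos_def n P" and neg: "neg_def n (transpose_mat A\<^sub>c\<^sub>l * P + P * A\<^sub>c\<^sub>l + Q\<^sub>\<alpha>
          + transpose_mat F\<^sub>s * R\<^sub>\<alpha> * F\<^sub>s)"
      using assms(8) unfolding Q\<^sub>\<alpha>_def R\<^sub>\<alpha>_def by blast
    show ?thesis
    proof (rule lyapunov_imp_hurwitz[OF Acl P])
      fix v :: "real vec" assume v: "v \<in> carrier_vec n" and v0: "v \<noteq> 0\<^sub>v n"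
      have "scalar_prod v ((transpose_mat A\<^sub>c\<^sub>l * P + P * A\<^sub>c\<^sub>l + Q\<^sub>\<alpha>
      + transpose_mat F\<^sub>s * R\<^sub>\<alpha> * F\<^sub>s) *\<^sub>v v) < 0"
        using neg v v0 by (simp add: neg_def_def)
      then show "scalar_prod v ((transpose_mat A\<^sub>c\<^sub>l * P + P * A\<^sub>c\<^sub>l) *\<^sub>v v) < 0"
        unfolding lmi_form[OF P v] using running[OF v] by linarith
    qed
  qed
  ultimately show ?thesis
    using assms(6,7) by (simp add: guaranteed_cost_structured_def Q\<^sub>\<alpha>_def R\<^sub>\<alpha>_def)
qed

end
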